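(* Let $(X,X_{\mathbb{R}},\|\cdot\|_X)$ be a normed complexified space with $X\neq\{0\}$, and put $$c_X=\sup_{0\ne x\in X}\frac{\|\operatorname{Re}x\|_X+\|\operatorname{Im}x\|_X}{\|x\|_X}\in[0,\infty].$$ Then for any normed complex vector space $(Y,\|\cdot\|_Y)$ and any $\mathbb{C}$-linear operator $A:X\to Y$, $$\|A\|_{X,Y}^{\mathbb{C}}\le c_X\,\|A\|_{X,Y}^{\mathbb{R}}.$$ Moreover: (a) If $\|\operatorname{Re}x\|_X\le\|x\|_X$ for all $x\in X$, then $c_X\le2$. (b) If $X_{\mathbb{R}}$ is endowed with an inner product $\langle\cdot,\cdot\rangle:X_{\mathbb{R}}\times X_{\mathbb{R}}\to\mathbb{R}$ and $\|\cdot\|_X$ is the norm induced by the complexification of this inner product, i.e. $\|x\|_X^2=\langle\operatorname{Re}x,\operatorname{Re}x\rangle+\langle\operatorname{Im}x,\operatorname{Im}x\rangle$ for all $x\in X$, then $c_X=\sqrt2$.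
   Context: A normed complexified space is a triple $(X,X_{\mathbb{R}},\|\cdot\|_X)$ where $X$ is a complex vector space, $X_{\mathbb{R}}$ is a real vector space, $X$ is the algebraic complexification of $X_{\mathbb{R}}$ (each $x\in X$ is uniquely $x=x_1+ix_2$ with $x_1,x_2\in X_{\mathbb{R}}$; put $\operatorname{Re}x=x_1$, $\operatorname{Im}x=x_2$), and $\|\cdot\|_X$ is a norm on the complex vector space $X$. The operator norms, with values in $[0,\infty]$ (with the convention $\infty\cdot0=0$), are $$\|A\|_{X,Y}^{\mathbb{C}}=\sup_{x\in X\setminus\{0\}}\frac{\|Ax\|_Y}{\|x\|_X},\qquad \|A\|_{X,Y}^{\mathbb{R}}=\sup_{x\in X_{\mathbb{R}}\setminus\{0\}}\frac{\|Ax\|_Y}{\|x\|_X}.$$ *)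

theory Defs
  imports Complex_Main "HOL-Library.Extended_Nonnegative_Real"
begin

locale complex_normed_space = vector_space scale
  for scale :: "complex \<Rightarrow> 'a::ab_group_add \<Rightarrow> 'a" +
  fixes nrm :: "'a \<Rightarrow> real"
  assumes nrm_eq_0_iff: "nrm x = 0 \<longleftrightarrow> x = 0"
    and nrm_triangle: "nrm (x + y) \<le> nrm x + nrm y"
    and nrm_scale: "nrm (scale c x) = cmod c * nrm x"

text \<open>The real space is given as a subset \<open>XR\<close> of the complex space, closed under the real
  vector space operations obtained by restricting the scalars to the reals.\<close>

locale normed_complexified_space = complex_normed_space scale nrm
  for scale :: "complex \<Rightarrow> 'a::ab_group_add \<Rightarrow> 'a" and XR :: "'a set" and nrm :: "'a \<Rightarrow> real" +
  assumes real_subspace: "module.subspace (\<lambda>r::real. scale (complex_of_real r)) XR"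
    and unique_decomposition:
      "\<exists>!p. fst p \<in> XR \<and> snd p \<in> XR \<and> x = fst p + scale \<i> (snd p)"

definition re_part :: "(complex \<Rightarrow> 'a::ab_group_add \<Rightarrow> 'a) \<Rightarrow> 'a set \<Rightarrow> 'a \<Rightarrow> 'a" where
  "re_part scale XR x = (THE x1. x1 \<in> XR \<and> (\<exists>x2\<in>XR. x = x1 + scale \<i> x2))"

definition im_part :: "(complex \<Rightarrow> 'a::ab_group_add \<Rightarrow> 'a) \<Rightarrow> 'a set \<Rightarrow> 'a \<Rightarrow> 'a" where
  "im_part scale XR x = (THE x2. x2 \<in> XR \<and> (\<exists>x1\<in>XR. x = x1 + scale \<i> x2))"

text \<open>Values in \<open>[0,\<infinity>]\<close> are of type \<^typ>\<open>ennreal\<close>, where \<open>\<infinity> * 0 = 0\<close> and the supremum of the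
  empty set is \<open>0\<close>.\<close>

definition opnorm_complex ::
  "('a::ab_group_add \<Rightarrow> real) \<Rightarrow> ('b \<Rightarrow> real) \<Rightarrow> ('a \<Rightarrow> 'b) \<Rightarrow> ennreal" where
  "opnorm_complex nX nY A = (SUP x\<in>UNIV - {0}. ennreal (nY (A x) / nX x))"

definition opnorm_real ::
  "'a::ab_group_add set \<Rightarrow> ('a \<Rightarrow> real) \<Rightarrow> ('b \<Rightarrow> real) \<Rightarrow> ('a \<Rightarrow> 'b) \<Rightarrow> ennreal" where
  "opnorm_real XR nX nY A = (SUP x\<in>XR - {0}. ennreal (nY (A x) / nX x))"

definition complexification_const ::
  "(complex \<Rightarrow> 'a::ab_group_add \<Rightarrow> 'a) \<Rightarrow> 'a set \<Rightarrow> ('a \<Rightarrow> real) \<Rightarrow> ennreal" where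
  "complexification_const scale XR nX =
     (SUP x\<in>UNIV - {0}. ennreal ((nX (re_part scale XR x) + nX (im_part scale XR x)) / nX x))"

definition real_inner_product_on ::
  "(complex \<Rightarrow> 'a::ab_group_add \<Rightarrow> 'a) \<Rightarrow> 'a set \<Rightarrow> ('a \<Rightarrow> 'a \<Rightarrow> real) \<Rightarrow> bool" where
  "real_inner_product_on scale XR ip \<longleftrightarrow>
     (\<forall>x\<in>XR. \<forall>y\<in>XR. ip x y = ip y x) \<and>
     (\<forall>x\<in>XR. \<forall>y\<in>XR. \<forall>z\<in>XR. ip (x + y) z = ip x z + ip y z) \<and>
     (\<forall>r::real. \<forall>x\<in>XR. \<forall>y\<in>XR. ip (scale (complex_of_real r) x) y = r * ip x y) \<and>
     (\<forall>x\<in>XR. 0 \<le> ip x x) \<and>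
     (\<forall>x\<in>XR. ip x x = 0 \<longleftrightarrow> x = 0)"

end

theory Submission
  imports Defs
begin

text \<open>
  Write \<open>x = u + \<i> v\<close> with \<open>u = Re x\<close> and \<open>v = Im x\<close>. Multiplication by \<open>\<i>\<close> preserves norms, so
  \<open>\<parallel>A x\<parallel> \<le> \<parallel>A u\<parallel> + \<parallel>A v\<parallel> \<le> \<parallel>A\<parallel>\<^sub>\<real> (\<parallel>u\<parallel> + \<parallel>v\<parallel>)\<close>, and \<open>c\<^sub>X\<close> is by definition the least constant in
  \<open>[0,\<infinity>]\<close> with \<open>\<parallel>u\<parallel> + \<parallel>v\<parallel> \<le> c\<^sub>X \<parallel>x\<parallel>\<close>; this is the inequality of operator norms.

  For (a), a bound on real parts is also a bound on imaginary parts, because \<open>Im x = Re (-\<i> x)\<close>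
  and \<open>-\<i> x\<close> has the same norm as \<open>x\<close>.

  For (b), the hypothesis amounts to the Pythagorean identity \<open>\<parallel>x\<parallel>\<^sup>2 = \<parallel>u\<parallel>\<^sup>2 + \<parallel>v\<parallel>\<^sup>2\<close>; hence
  \<open>\<parallel>u\<parallel> + \<parallel>v\<parallel> \<le> \<surd>2 \<parallel>x\<parallel>\<close>, with equality at \<open>x = u + \<i> u\<close> for any real vector \<open>u \<noteq> 0\<close>.
\<close>

context complex_normed_space
begin

lemma nrm_minus: "nrm (- x) = nrm x"
  using nrm_scale[of "-1" x] by simp

lemma nrm_nonneg: "0 \<le> nrm x"
proof -
  have "nrm (x + - x) \<le> nrm x + nrm (- x)"
    by (rule nrm_triangle)
  then show ?thesis
    using nrm_eq_0_iff[of 0] by (simp add: nrm_minus)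
qed

lemma nrm_pos: "x \<noteq> 0 \<Longrightarrow> 0 < nrm x"
  using nrm_nonneg[of x] nrm_eq_0_iff[of x] by linarith

end

context normed_complexified_space
begin

lemma module_real_scale: "module (\<lambda>r::real. scale (complex_of_real r))"
  by unfold_locales
    (simp_all add: scale_right_distrib scale_left_distrib)

lemma zero_in_XR: "0 \<in> XR"
  using real_subspace module.subspace_0[OF module_real_scale] by blast

lemma minus_in_XR: "x \<in> XR \<Longrightarrow> - x \<in> XR"
  using real_subspace module.subspace_neg[OF module_real_scale] by blast

lemma decomposition_unique:
  assumes "u \<in> XR" "v \<in> XR" "u' \<in> XR" "v' \<in> XR"
    and "u + scale \<i> v = u' + scale \<i> v'"
  shows "u = u' \<and> v = v'"
proof -
  note the_eq = the1_equality[OF unique_decomposition[of "u + scale \<i> v"]]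
  have "(u, v) = (u', v')"
    by (rule trans[OF sym[OF the_eq] the_eq]) (simp_all add: assms)
  then show ?thesis by simp
qed

lemma re_part_eq: "u \<in> XR \<Longrightarrow> v \<in> XR \<Longrightarrow> re_part scale XR (u + scale \<i> v) = u"
  unfolding re_part_def using decomposition_unique by (intro the_equality) metis+

lemma im_part_eq: "u \<in> XR \<Longrightarrow> v \<in> XR \<Longrightarrow> im_part scale XR (u + scale \<i> v) = v"
  unfolding im_part_def using decomposition_unique by (intro the_equality) metis+

lemma obtain_parts:
  fixes x :: 'a
  obtains u v where "u \<in> XR" "v \<in> XR" "x = u + scale \<i> v"
    "re_part scale XR x = u" "im_part scale XR x = v"
proof -
  obtain u v where "u \<in> XR" "v \<in> XR" "x = u + scale \<i> v"
    using ex1_implies_ex[OF unique_decomposition[of x]] by auto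
  then show ?thesis
    using that[of u v] re_part_eq[of u v] im_part_eq[of u v] by simp
qed

lemma XR_nontrivial:
  fixes x :: 'a
  assumes "x \<noteq> 0"
  obtains u where "u \<in> XR" "u \<noteq> 0"
proof -
  obtain u v where "u \<in> XR" "v \<in> XR" "x = u + scale \<i> v"
    by (rule obtain_parts)
  then have "u \<noteq> 0 \<or> v \<noteq> 0"
    using assms by auto
  with \<open>u \<in> XR\<close> \<open>v \<in> XR\<close> show ?thesis
    using that by blast
qed

lemma complexification_const_upper:
  assumes "x \<noteq> 0"
  shows "ennreal ((nrm (re_part scale XR x) + nrm (im_part scale XR x)) / nrm x)
           \<le> complexification_const scale XR nrm"
  unfolding complexification_const_def using assms by (intro SUP_upper) simp

lemma complexification_const_least:
  assumes "\<And>x. nrm (re_part scale XR x) + nrm (im_part scale XR x) \<le> c * nrm x"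
  shows "complexification_const scale XR nrm \<le> ennreal c"
  unfolding complexification_const_def
proof (rule SUP_least)
  fix x :: 'a
  assume "x \<in> UNIV - {0}"
  then have "0 < nrm x" by (simp add: nrm_pos)
  then show "ennreal ((nrm (re_part scale XR x) + nrm (im_part scale XR x)) / nrm x) \<le> ennreal c"
    using assms[of x] by (intro ennreal_leI) (simp add: divide_le_eq)
qed

text \<open>For \<open>x \<noteq> 0\<close> this is the definition of the supremum. The case \<open>x = 0\<close> lies outside the
  supremum, but real and imaginary parts of a nonzero vector may vanish; there the convention
  \<open>\<infinity> * 0 = 0\<close> is harmless because \<open>A 0 = 0\<close>.\<close>

lemma opnorm_real_bound:
  assumes A: "Vector_Spaces.linear scale scaleY A" and Y: "complex_normed_space scaleY nY"
    and "x \<in> XR"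
  shows "ennreal (nY (A x)) \<le> opnorm_real XR nrm nY A * ennreal (nrm x)"
proof (cases "x = 0")
  case True
  interpret A: Vector_Spaces.linear scale scaleY A by fact
  interpret Y: complex_normed_space scaleY nY by fact
  show ?thesis
    using True A.zero Y.nrm_eq_0_iff[of 0] by simp
next
  case False
  have "ennreal (nY (A x)) = ennreal (nY (A x) / nrm x) * ennreal (nrm x)"
    using nrm_pos[OF False] by (simp flip: ennreal_mult'')
  also have "\<dots> \<le> opnorm_real XR nrm nY A * ennreal (nrm x)"
    unfolding opnorm_real_def using False \<open>x \<in> XR\<close>
    by (intro mult_right_mono SUP_upper) auto
  finally show ?thesis .
qed

theorem opnorm_complex_le:
  assumes A: "Vector_Spaces.linear scale scaleY A" and Y: "complex_normed_space scaleY nY"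
  shows "opnorm_complex nrm nY A \<le> complexification_const scale XR nrm * opnorm_real XR nrm nY A"
  unfolding opnorm_complex_def
proof (rule SUP_least)
  interpret A: Vector_Spaces.linear scale scaleY A by fact
  interpret Y: complex_normed_space scaleY nY by fact
  let ?R = "opnorm_real XR nrm nY A"
  fix x :: 'a
  assume "x \<in> UNIV - {0}"
  then have "x \<noteq> 0" by simp
  then have x: "0 < nrm x" by (rule nrm_pos)
  obtain u v where uv: "u \<in> XR" "v \<in> XR" "x = u + scale \<i> v"
    and parts: "re_part scale XR x = u" "im_part scale XR x = v"
    by (rule obtain_parts)
  have "nY (A x) \<le> nY (A u) + nY (scaleY \<i> (A v))"
    unfolding uv(3) A.add A.scale by (rule Y.nrm_triangle)
  then have "nY (A x) \<le> nY (A u) + nY (A v)"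
    by (simp add: Y.nrm_scale)
  then have "ennreal (nY (A x)) \<le> ennreal (nY (A u)) + ennreal (nY (A v))"
    by (simp add: Y.nrm_nonneg flip: ennreal_plus)
  also have "\<dots> \<le> ?R * ennreal (nrm u) + ?R * ennreal (nrm v)"
    using opnorm_real_bound[OF A Y] uv by (intro add_mono) auto
  also have "\<dots> = ?R * ennreal (nrm u + nrm v)"
    by (simp add: nrm_nonneg distrib_left)
  finally have *: "ennreal (nY (A x)) \<le> ?R * ennreal (nrm u + nrm v)" .
  have "ennreal (nY (A x) / nrm x) = ennreal (nY (A x)) * ennreal (1 / nrm x)"
    using x by (simp add: Y.nrm_nonneg flip: ennreal_mult)
  also have "\<dots> \<le> ?R * ennreal (nrm u + nrm v) * ennreal (1 / nrm x)"
    by (intro mult_right_mono *) simp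
  also have "\<dots> = ?R * ennreal ((nrm u + nrm v) / nrm x)"
    using x by (simp add: nrm_nonneg mult.assoc flip: ennreal_mult ennreal_plus)
  also have "\<dots> \<le> ?R * complexification_const scale XR nrm"
    using complexification_const_upper[OF \<open>x \<noteq> 0\<close>] parts by (intro mult_left_mono) auto
  finally show "ennreal (nY (A x) / nrm x) \<le> complexification_const scale XR nrm * ?R"
    by (simp add: mult.commute)
qed

text \<open>If \<open>x = u + \<i> v\<close> then \<open>-\<i> x = v + \<i> (-u)\<close>, which is again a decomposition into parts in \<open>XR\<close>.\<close>

lemma im_part_eq_re_part: "im_part scale XR x = re_part scale XR (scale (- \<i>) x)"
proof -
  obtain u v where uv: "u \<in> XR" "v \<in> XR" "x = u + scale \<i> v" and "im_part scale XR x = v"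
    by (rule obtain_parts)
  moreover have "scale (- \<i>) x = v + scale \<i> (- u)"
    by (simp add: uv(3) scale_right_distrib)
  ultimately show ?thesis
    by (simp add: re_part_eq minus_in_XR del: scale_minus_left scale_minus_right)
qed

theorem complexification_const_le_2:
  assumes "\<And>x. nrm (re_part scale XR x) \<le> nrm x"
  shows "complexification_const scale XR nrm \<le> 2"
proof -
  have "nrm (im_part scale XR x) \<le> nrm x" for x
    using assms[of "scale (- \<i>) x"] by (simp only: im_part_eq_re_part nrm_scale) simp
  then have "complexification_const scale XR nrm \<le> ennreal 2"
    using assms by (intro complexification_const_least) (smt (verit))
  then show ?thesis by simp
qed

theorem complexification_const_pythagorean:
  assumes pythagoras: "\<And>x. (nrm x)\<^sup>2 = (nrm (re_part scale XR x))\<^sup>2 + (nrm (im_part scale XR x))\<^sup>2"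
    and "\<exists>x::'a. x \<noteq> 0"
  shows "complexification_const scale XR nrm = ennreal (sqrt 2)"
proof (rule antisym)
  show "complexification_const scale XR nrm \<le> ennreal (sqrt 2)"
  proof (rule complexification_const_least, rule power2_le_imp_le)
    fix x
    let ?a = "nrm (re_part scale XR x)" and ?b = "nrm (im_part scale XR x)"
    have "(?a + ?b)\<^sup>2 \<le> 2 * (?a\<^sup>2 + ?b\<^sup>2)"
      using zero_le_power2[of "?a - ?b"] by (simp add: power2_eq_square algebra_simps)
    then show "(?a + ?b)\<^sup>2 \<le> (sqrt 2 * nrm x)\<^sup>2"
      by (simp add: power_mult_distrib pythagoras[of x])
  qed (simp add: nrm_nonneg)
next
  obtain u where u: "u \<in> XR" "u \<noteq> 0"
    using assms(2) XR_nontrivial by blast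
  define x where "x = u + scale \<i> u"
  have parts: "re_part scale XR x = u" "im_part scale XR x = u"
    using u by (simp_all add: x_def re_part_eq im_part_eq)
  have "(nrm x)\<^sup>2 = (sqrt 2 * nrm u)\<^sup>2"
    by (simp add: pythagoras[of x] parts power_mult_distrib)
  then have nx: "nrm x = sqrt 2 * nrm u"
    by (rule power2_eq_imp_eq) (simp_all add: nrm_nonneg)
  have pos: "0 < nrm u"
    using u(2) by (rule nrm_pos)
  then have "x \<noteq> 0"
    using nx nrm_eq_0_iff[of x] by auto
  have "(nrm u + nrm u) / nrm x = sqrt 2"
    using pos by (simp add: nx field_simps)
  then show "ennreal (sqrt 2) \<le> complexification_const scale XR nrm"
    using complexification_const_upper[OF \<open>x \<noteq> 0\<close>] by (simp add: parts)
qed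

text \<open>For \<open>u \<in> XR\<close> the imaginary part is \<open>0\<close>, so the formula for the norm restricts to
  \<open>\<parallel>u\<parallel>\<^sup>2 = \<langle>u, u\<rangle>\<close>; inserting this back turns it into the Pythagorean identity.\<close>

lemma inner_product_pythagorean:
  assumes ip: "real_inner_product_on scale XR ip"
    and norm: "\<And>x. (nrm x)\<^sup>2 = ip (re_part scale XR x) (re_part scale XR x)
                          + ip (im_part scale XR x) (im_part scale XR x)"
  shows "(nrm x)\<^sup>2 = (nrm (re_part scale XR x))\<^sup>2 + (nrm (im_part scale XR x))\<^sup>2"
proof -
  have ip_0: "ip 0 0 = 0"
    using ip zero_in_XR by (simp add: real_inner_product_on_def)
  have "(nrm u)\<^sup>2 = ip u u" if "u \<in> XR" for u
    using norm[of u] re_part_eq[OF that zero_in_XR] im_part_eq[OF that zero_in_XR] ip_0 by simp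
  moreover have "re_part scale XR x \<in> XR" "im_part scale XR x \<in> XR"
    by (rule obtain_parts[of x]; simp)+
  ultimately show ?thesis
    using norm[of x] by simp
qed

end

theorem proposition2p1:
  fixes scaleX :: "complex \<Rightarrow> 'a::ab_group_add \<Rightarrow> 'a"
    and XR :: "'a set"
    and nX :: "'a \<Rightarrow> real"
  assumes X: "normed_complexified_space scaleX XR nX"
    and X_nontrivial: "\<exists>x::'a. x \<noteq> 0"
  shows "(\<forall>(scaleY :: complex \<Rightarrow> 'b::ab_group_add \<Rightarrow> 'b) (nY :: 'b \<Rightarrow> real) (A :: 'a \<Rightarrow> 'b).
            complex_normed_space scaleY nY \<longrightarrow> Vector_Spaces.linear scaleX scaleY A \<longrightarrow>
            opnorm_complex nX nY A \<le> complexification_const scaleX XR nX * opnorm_real XR nX nY A)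
       \<and> ((\<forall>x. nX (re_part scaleX XR x) \<le> nX x) \<longrightarrow> complexification_const scaleX XR nX \<le> 2)
       \<and> (\<forall>ip :: 'a \<Rightarrow> 'a \<Rightarrow> real.
            real_inner_product_on scaleX XR ip \<longrightarrow>
            (\<forall>x. (nX x)\<^sup>2 = ip (re_part scaleX XR x) (re_part scaleX XR x)
                          + ip (im_part scaleX XR x) (im_part scaleX XR x)) \<longrightarrow>
            complexification_const scaleX XR nX = ennreal (sqrt 2))"
proof -
  interpret normed_complexified_space scaleX XR nX by fact
  show ?thesis
  proof (intro conjI allI impI)
    fix scaleY :: "complex \<Rightarrow> 'b \<Rightarrow> 'b" and nY A
    assume "complex_normed_space scaleY nY" "Vector_Spaces.linear scaleX scaleY A"
    then show "opnorm_complex nX nY A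
                 \<le> complexification_const scaleX XR nX * opnorm_real XR nX nY A"
      by (intro opnorm_complex_le)
  next
    assume "\<forall>x. nX (re_part scaleX XR x) \<le> nX x"
    then show "complexification_const scaleX XR nX \<le> 2"
      by (intro complexification_const_le_2) simp
  next
    fix ip :: "'a \<Rightarrow> 'a \<Rightarrow> real"
    assume ip: "real_inner_product_on scaleX XR ip"
      and "\<forall>x. (nX x)\<^sup>2 = ip (re_part scaleX XR x) (re_part scaleX XR x)
                     + ip (im_part scaleX XR x) (im_part scaleX XR x)"
    then show "complexification_const scaleX XR nX = ennreal (sqrt 2)"
      by (intro complexification_const_pythagorean X_nontrivial
            inner_product_pythagorean[OF ip]) blast
  qed
qed

end
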